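(* Let $X$ be a Banach space, $(A_n)_{n\in\mathbb{Z}}\subset B(X)$, $D\geqslant 1$, $\varepsilon\geqslant 0$ and $a,b\in\mathbb{R}$. Suppose that the equation $x_{n+1}=A_nx_n$, $n\in\mathbb{Z}$, admits a general dichotomy with bounds $$a_{m,n}=D\,e^{a(m-n)+\varepsilon|n|}\ \ ((m,n)\in\mathbb{Z}^2_{\geqslant})\qquad\text{and}\qquad b_{m,n}=D\,e^{b(m-n)+\varepsilon|n|}\ \ ((m,n)\in\mathbb{Z}^2_{\leqslant}).$$ Let $B_n:X\to X$, $n\in\mathbb{Z}$, be bounded linear operators such that $\|B_n\|\leqslant\delta e^{-\gamma|n+1|}$ for all $n\in\mathbb{Z}$, for some $\delta>0$ and some $\gamma\in\mathbb{R}$. If $$a\leqslant b,\qquad \varepsilon-\gamma<0\qquad\text{and}\qquad \theta:=D\delta e^{-a}\left(e^{\varepsilon-\gamma}+1\right)\left(1-e^{\varepsilon-\gamma}\right)^{-1}<1,$$ then the equation $x_{n+1}=(A_n+B_n)x_n$, $n\in\mathbb{Z}$, admits a general dichotomy with bounds $\frac{D}{1-\theta}e^{a(m-n)+\varepsilon|n|}$ (for $(m,n)\in\mathbb{Z}^2_{\geqslant}$) and $\frac{D}{1-\theta}e^{b(m-n)+\varepsilon|n|}$ (for $(m,n)\in\mathbb{Z}^2_{\leqslant}$).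
   Context: $B(X)$ is the space of bounded linear operators on the Banach space $X$. $\mathbb{Z}^2_{\geqslant}=\{(m,n)\in\mathbb{Z}^2: m\geqslant n\}$ and $\mathbb{Z}^2_{\leqslant}=\{(m,n)\in\mathbb{Z}^2: m\leqslant n\}$. For $(A_n)_{n\in\mathbb{Z}}\subset B(X)$ and $m\geqslant n$, put $\mathcal{A}_{m,n}=A_{m-1}\cdots A_n$ if $m>n$ and $\mathcal{A}_{n,n}=\mathrm{Id}$. The equation $x_{n+1}=A_nx_n$, $n\in\mathbb{Z}$, admits an invariant splitting if there are bounded projections $P_n\in B(X)$, $n\in\mathbb{Z}$, such that for every $(m,n)\in\mathbb{Z}^2_{\geqslant}$: (S1) $P_m\mathcal{A}_{m,n}=\mathcal{A}_{m,n}P_n$; (S2) $\mathcal{A}_{m,n}(\ker P_n)=\ker P_m$; (S3) $\mathcal{A}_{m,n}|_{\ker P_n}:\ker P_n\to\ker P_m$ is invertible (with bounded inverse). In that case, for $m\geqslant n$, $\mathcal{A}_{n,m}:\ker P_m\to\ker P_n$ denotes the inverse of $\mathcal{A}_{m,n}|_{\ker P_n}$, and $Q_n=\mathrm{Id}-P_n$. The equation admits a general dichotomy with bounds $(a_{m,n})_{(m,n)\in\mathbb{Z}^2_{\geqslant}}$ and $(b_{m,n})_{(m,n)\in\mathbb{Z}^2_{\leqslant}}$ if it admits an invariant splitting such that (D1) $\|\mathcal{A}_{m,n}P_n\|\leqslant a_{m,n}$ for all $(m,n)\in\mathbb{Z}^2_{\geqslant}$ and (D2) $\|\mathcal{A}_{m,n}Q_n\|\leqslant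 b_{m,n}$ for all $(m,n)\in\mathbb{Z}^2_{\leqslant}$. *)

theory Defs
  imports "HOL-Analysis.Analysis"
begin

primrec evolution_steps ::
    "(int \<Rightarrow> 'a::real_normed_vector \<Rightarrow>\<^sub>L 'a) \<Rightarrow> int \<Rightarrow> nat \<Rightarrow> 'a \<Rightarrow>\<^sub>L 'a" where
  "evolution_steps A n 0 = id_blinfun"
| "evolution_steps A n (Suc k) = A (n + int k) o\<^sub>L evolution_steps A n k"

(* The product A (m - 1) ... A n; only meaningful for m >= n, since nat truncates. *)
definition evolution ::
    "(int \<Rightarrow> 'a::real_normed_vector \<Rightarrow>\<^sub>L 'a) \<Rightarrow> int \<Rightarrow> int \<Rightarrow> 'a \<Rightarrow>\<^sub>L 'a" where
  "evolution A m n = evolution_steps A n (nat (m - n))"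

definition ker :: "('a::real_normed_vector \<Rightarrow>\<^sub>L 'b::real_normed_vector) \<Rightarrow> 'a set" where
  "ker T = {x. blinfun_apply T x = 0}"

(* For m <= n, the inverse ker (P n) -> ker (P m) of the restriction of evolution A n m
   to ker (P m); unspecified outside ker (P n). *)
definition backward_evolution ::
    "(int \<Rightarrow> 'a::real_normed_vector \<Rightarrow>\<^sub>L 'a) \<Rightarrow> (int \<Rightarrow> 'a \<Rightarrow>\<^sub>L 'a) \<Rightarrow> int \<Rightarrow> int \<Rightarrow> 'a \<Rightarrow> 'a" where
  "backward_evolution A P m n = inv_into (ker (P m)) (blinfun_apply (evolution A n m))"

definition invariant_splitting ::
    "(int \<Rightarrow> 'a::real_normed_vector \<Rightarrow>\<^sub>L 'a) \<Rightarrow> (int \<Rightarrow> 'a \<Rightarrow>\<^sub>L 'a) \<Rightarrow> bool" where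
  "invariant_splitting A P \<longleftrightarrow>
     (\<forall>n. P n o\<^sub>L P n = P n) \<and>
     (\<forall>m n. n \<le> m \<longrightarrow>
        P m o\<^sub>L evolution A m n = evolution A m n o\<^sub>L P n \<and>
        blinfun_apply (evolution A m n) ` ker (P n) = ker (P m) \<and>
        bij_betw (blinfun_apply (evolution A m n)) (ker (P n)) (ker (P m)) \<and>
        (\<exists>C. \<forall>y \<in> ker (P m). norm (backward_evolution A P n m y) \<le> C * norm y))"

(* The bound a is only used for m >= n and b only for m <= n.  In the second estimate
   id_blinfun - P n maps into ker (P n), so the function under onorm is bounded linear. *)
definition general_dichotomy ::
    "(int \<Rightarrow> 'a::real_normed_vector \<Rightarrow>\<^sub>L 'a) \<Rightarrow>
     (int \<Rightarrow> int \<Rightarrow> real) \<Rightarrow> (int \<Rightarrow> int \<Rightarrow> real) \<Rightarrow> bool" where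
  "general_dichotomy A a b \<longleftrightarrow>
     (\<exists>P. invariant_splitting A P \<and>
        (\<forall>m n. n \<le> m \<longrightarrow> norm (evolution A m n o\<^sub>L P n) \<le> a m n) \<and>
        (\<forall>m n. m \<le> n \<longrightarrow>
           onorm (\<lambda>x. backward_evolution A P m n (blinfun_apply (id_blinfun - P n) x)) \<le> b m n))"

end

(* A dichotomy is encoded by its Green kernel G m n, equal to A_{m,n} P_n for n <= m and to
   - A_{m,n} Q_n for m < n. The Green kernel H of the perturbed equation is the solution of
   H m n = G m n + (SUM k. G m (k + 1) B_k H k n). Since a <= b, both bounds are expressed by the
   single weight w m n = exp (min (a (m - n)) (b (m - n))), and
   w m (k + 1) * w k n <= exp (- a) * w m n; together with (SUM k. q^|k + 1|) = (1 + q) / (1 - q),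
   q = exp (epsilon - gamma), this makes the right-hand side a contraction with constant theta on
   the sequences in m bounded by a multiple of w m n. The existence of H, the right recursion and
   the idempotence of H n n all come from this contraction: bounded solutions of
   x_{m+1} = (A_m + B_m) x_m themselves need not be unique, so uniqueness is only used for the
   summation equation. *)
theory Submission
  imports Defs
begin

section \<open>Algebra of operator composition\<close>

interpretation blinfun_compose: bounded_bilinear "(o\<^sub>L)"
  by (rule bounded_bilinear_blinfun_compose)

lemma blinfun_compose_assoc: "(f o\<^sub>L g) o\<^sub>L h = f o\<^sub>L (g o\<^sub>L h)"
  by (rule blinfun_eqI) simp

lemma blinfun_compose_id_left [simp]: "id_blinfun o\<^sub>L f = f"
  by (rule blinfun_eqI) simp

lemma blinfun_compose_id_right [simp]: "f o\<^sub>L id_blinfun = f"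
  by (rule blinfun_eqI) simp

lemmas blinfun_compose_algebra =
  blinfun_compose_assoc blinfun_compose.add_left blinfun_compose.add_right
  blinfun_compose.diff_left blinfun_compose.diff_right
  blinfun_compose.minus_left blinfun_compose.minus_right

section \<open>Green kernels of dichotomies\<close>

lemma evolution_refl [simp]: "evolution A n n = id_blinfun"
  by (simp add: evolution_def)

lemma evolution_Suc: "n \<le> m \<Longrightarrow> evolution A (m + 1) n = A m o\<^sub>L evolution A m n"
proof -
  assume "n \<le> m"
  then have "nat (m + 1 - n) = Suc (nat (m - n))" by simp
  with \<open>n \<le> m\<close> show ?thesis by (simp add: evolution_def)
qed

lemma evolution_step: "evolution A (m + 1) m = A m"
  by (simp add: evolution_Suc)

lemma evolution_compose:
  assumes "n \<le> k" "k \<le> m"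
  shows "evolution A m k o\<^sub>L evolution A k n = evolution A m n"
  using assms(2)
proof (induction m rule: int_ge_induct)
  case (step m)
  then show ?case using assms(1) by (simp add: evolution_Suc blinfun_compose_assoc)
qed simp

text \<open>The third clause says both that \<open>G n n\<close> is a projection and that the backward part
  vanishes on its range.\<close>
definition green_kernel ::
    "(int \<Rightarrow> 'a::real_normed_vector \<Rightarrow>\<^sub>L 'a) \<Rightarrow> (int \<Rightarrow> int \<Rightarrow> 'a \<Rightarrow>\<^sub>L 'a) \<Rightarrow> bool" where
  "green_kernel A G \<longleftrightarrow>
     (\<forall>m n. G (m + 1) n = (A m o\<^sub>L G m n) + (if m + 1 = n then id_blinfun else 0)) \<and>
     (\<forall>m n. G m n = (G m (n + 1) o\<^sub>L A n) + (if m = n then id_blinfun else 0)) \<and>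
     (\<forall>m n. G m n o\<^sub>L G n n = (if n \<le> m then G m n else 0))"

section \<open>From a Green kernel to projections and backward evolution\<close>

locale green =
  fixes A :: "int \<Rightarrow> 'a::real_normed_vector \<Rightarrow>\<^sub>L 'a" and G
  assumes green: "green_kernel A G"
begin

lemma left: "G (m + 1) n = (A m o\<^sub>L G m n) + (if m + 1 = n then id_blinfun else 0)"
  and right: "G m n = (G m (n + 1) o\<^sub>L A n) + (if m = n then id_blinfun else 0)"
  and absorb: "G m n o\<^sub>L G n n = (if n \<le> m then G m n else 0)"
  using green unfolding green_kernel_def by blast+

text \<open>For \<open>m \<le> n\<close> this is the backward evolution \<open>\<A>\<^bsub>m,n\<^esub> Q\<^sub>n\<close>; it has no meaning for \<open>m > n\<close>.\<close>
definition S :: "int \<Rightarrow> int \<Rightarrow> 'a \<Rightarrow>\<^sub>L 'a" where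
  "S m n = (if m = n then id_blinfun else 0) - G m n"

lemma S_diag: "S n n = id_blinfun - G n n"
  by (simp add: S_def)

lemma S_left: "m < n \<Longrightarrow> A m o\<^sub>L S m n = S (m + 1) n"
  using left[of m n] by (simp add: S_def blinfun_compose_algebra)

lemma S_right: "m \<le> n \<Longrightarrow> S m (n + 1) o\<^sub>L A n = S m n"
  using right[of m n] by (auto simp: S_def blinfun_compose_algebra)

lemma G_diag_idem: "G n n o\<^sub>L G n n = G n n"
  by (simp add: absorb)

lemma S_diag_idem: "S n n o\<^sub>L S n n = S n n"
  by (simp add: S_diag blinfun_compose_algebra G_diag_idem)

lemma S_absorb: "m \<le> n \<Longrightarrow> S m n o\<^sub>L S n n = S m n"
  using absorb[of m n] by (cases "m = n") (auto simp: S_diag_idem, auto simp: S_def blinfun_compose_algebra)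

lemma evolution_G: "n \<le> m \<Longrightarrow> evolution A m n o\<^sub>L G n n = G m n"
proof (induction m rule: int_ge_induct)
  case (step m)
  then show ?case using left[of m n] by (simp add: evolution_Suc blinfun_compose_assoc)
qed simp

lemma evolution_S: "k \<le> m \<Longrightarrow> m \<le> n \<Longrightarrow> evolution A m k o\<^sub>L S k n = S m n"
proof (induction m rule: int_ge_induct)
  case (step m)
  then show ?case by (simp add: evolution_Suc blinfun_compose_assoc S_left)
qed simp

lemma S_evolution: "m \<le> n \<Longrightarrow> n \<le> k \<Longrightarrow> S m k o\<^sub>L evolution A k n = S m n"
proof -
  assume m: "m \<le> n"
  assume "n \<le> k"
  then show ?thesis
  proof (induction k rule: int_ge_induct)
    case (step k)
    have "S m (k + 1) o\<^sub>L evolution A (k + 1) n = (S m (k + 1) o\<^sub>L A k) o\<^sub>L evolution A k n"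
      using step by (simp add: evolution_Suc blinfun_compose_assoc)
    then show ?case using step m by (simp add: S_right)
  qed simp
qed

text \<open>Composing \<open>S m n\<close> with the evolution from k to n gives
  \<open>S m k\<close>, while the same evolution carries \<open>S k n\<close> to
  \<open>S n n\<close>, which \<open>S m n\<close> absorbs.\<close>

lemma S_compose:
  assumes "m \<le> k" "k \<le> n"
  shows "S m k o\<^sub>L S k n = S m n"
proof -
  have "S m k o\<^sub>L S k n = S m n o\<^sub>L (evolution A n k o\<^sub>L S k n)"
    using assms by (simp add: S_evolution flip: blinfun_compose_assoc)
  also have "\<dots> = S m n"
    using assms by (simp add: evolution_S S_absorb)
  finally show ?thesis .
qed

lemma diag_S: "m \<le> n \<Longrightarrow> G m m o\<^sub>L S m n = 0"
  using S_compose[of m m n] by (simp add: S_diag blinfun_compose_algebra)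

text \<open>Both sides equal
  \<open>evolution A m n o\<^sub>L S n m o\<^sub>L evolution A m n\<close>; passing to complements
  gives (S1).\<close>

lemma evolution_diag_S: "n \<le> m \<Longrightarrow> evolution A m n o\<^sub>L S n n = S m m o\<^sub>L evolution A m n"
  using evolution_S[of n m m] S_evolution[of n n m] by (metis blinfun_compose_assoc order_refl)

lemma evolution_diag: "n \<le> m \<Longrightarrow> G m m o\<^sub>L evolution A m n = evolution A m n o\<^sub>L G n n"
  using evolution_diag_S[of n m] by (simp add: S_diag blinfun_compose_algebra)

lemma G_lower: "m < n \<Longrightarrow> G m n = - S m n"
  by (simp add: S_def)

lemma diag_G: "G m m o\<^sub>L G m n = (if n \<le> m then G m n else 0)"
proof (cases "n \<le> m")
  case True
  then have "G m m o\<^sub>L G m n = (G m m o\<^sub>L evolution A m n) o\<^sub>L G n n"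
    by (simp add: blinfun_compose_assoc evolution_G)
  also have "\<dots> = G m n"
    using True by (simp add: evolution_diag blinfun_compose_assoc G_diag_idem evolution_G absorb)
  finally show ?thesis using True by simp
next
  case False
  then show ?thesis by (simp add: G_lower blinfun_compose.minus_right diag_S)
qed

text \<open>A cocycle law with a sign: the factor is 1 for n \<le> k \<le> m, -1 for m < k < n and 0
  otherwise, since the forward part acts on the ranges of the projections and the backward part on
  their kernels.\<close>

lemma G_compose: "G m k o\<^sub>L G k n = (of_bool (k \<le> m) - of_bool (k < n)) *\<^sub>R G m n"
proof (cases "k < n")
  case lt: True
  show ?thesis
  proof (cases "k \<le> m")
    case True
    then have "G m k o\<^sub>L G k n = evolution A m k o\<^sub>L (G k k o\<^sub>L G k n)"
      by (simp add: evolution_G flip: blinfun_compose_assoc)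
    then show ?thesis using lt True by (simp add: diag_G)
  next
    case False
    then show ?thesis using lt
      by (simp add: G_lower S_compose blinfun_compose.minus_left blinfun_compose.minus_right)
  qed
next
  case ge: False
  show ?thesis
  proof (cases "k \<le> m")
    case True
    have "G m k o\<^sub>L G k n = evolution A m k o\<^sub>L (G k k o\<^sub>L G k n)"
      using True by (simp add: evolution_G flip: blinfun_compose_assoc)
    also have "\<dots> = evolution A m k o\<^sub>L evolution A k n o\<^sub>L G n n"
      using ge by (simp add: diag_G evolution_G blinfun_compose_assoc)
    also have "\<dots> = G m n"
      using ge True by (simp add: evolution_compose evolution_G)
    finally show ?thesis using ge True by simp
  next
    case False
    have "G m k o\<^sub>L G k n = (G m k o\<^sub>L G k k) o\<^sub>L G k n"
      using ge by (simp add: blinfun_compose_assoc diag_G)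
    then show ?thesis using ge False by (simp add: absorb)
  qed
qed

lemma ker_iff: "x \<in> ker (G n n) \<longleftrightarrow> S n n x = x"
  by (auto simp: ker_def S_diag blinfun.diff_left)

lemma S_in_ker: "m \<le> n \<Longrightarrow> S m n x \<in> ker (G m m)"
  using arg_cong[OF diag_S[of m n], of "\<lambda>f. blinfun_apply f x"] by (simp add: ker_def)

lemma evolution_S_ker:
  assumes "n \<le> m" "y \<in> ker (G m m)"
  shows "evolution A m n (S n m y) = y"
  using assms arg_cong[OF evolution_S[of n m m], of "\<lambda>f. blinfun_apply f y"]
  by (simp add: ker_iff)

lemma S_evolution_ker:
  assumes "n \<le> m" "x \<in> ker (G n n)"
  shows "S n m (evolution A m n x) = x"
  using assms arg_cong[OF S_evolution[of n n m], of "\<lambda>f. blinfun_apply f x"]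
  by (simp add: ker_iff)

lemma evolution_in_ker:
  assumes "n \<le> m" "x \<in> ker (G n n)"
  shows "evolution A m n x \<in> ker (G m m)"
  using assms arg_cong[OF evolution_diag[of n m], of "\<lambda>f. blinfun_apply f x"]
  by (simp add: ker_def)

text \<open>The diagonal entries of \<open>S\<close> are the identity on the kernels, so
  \<open>S n m\<close> inverts the evolution there; this identifies it with the
  \<open>inv_into\<close> of \<open>backward_evolution\<close>.\<close>

lemma bij_betw_ker:
  "n \<le> m \<Longrightarrow> bij_betw (evolution A m n) (ker (G n n)) (ker (G m m))"
  by (rule bij_betw_byWitness[where f' = "S n m"])
    (auto simp: S_evolution_ker evolution_S_ker evolution_in_ker S_in_ker)

lemma backward_evolution_ker:
  assumes "n \<le> m" "y \<in> ker (G m m)"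
  shows "backward_evolution A (\<lambda>n. G n n) n m y = S n m y"
  unfolding backward_evolution_def using assms
  by (intro inv_into_f_eq)
    (auto simp: evolution_S_ker S_in_ker bij_betw_imp_inj_on[OF bij_betw_ker])

lemma invariant_splitting: "invariant_splitting A (\<lambda>n. G n n)"
  unfolding invariant_splitting_def
proof (intro conjI allI impI)
  fix m n :: int
  assume nm: "n \<le> m"
  show "\<exists>C. \<forall>y\<in>ker (G m m). norm (backward_evolution A (\<lambda>n. G n n) n m y) \<le> C * norm y"
    using nm by (intro exI[of _ "norm (S n m)"]) (auto simp: backward_evolution_ker norm_blinfun)
  show "evolution A m n ` ker (G n n) = ker (G m m)"
    using bij_betw_ker[OF nm] by (simp add: bij_betw_def)
qed (simp_all add: G_diag_idem evolution_diag bij_betw_ker)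

lemma onorm_backward_evolution:
  assumes "m \<le> n"
  shows "onorm (\<lambda>x. backward_evolution A (\<lambda>n. G n n) m n ((id_blinfun - G n n) x)) = norm (S m n)"
proof -
  have "backward_evolution A (\<lambda>n. G n n) m n ((id_blinfun - G n n) x) = S m n x" for x
    using assms arg_cong[OF S_absorb[of m n], of "\<lambda>f. blinfun_apply f x"] S_in_ker[of n n x]
    by (simp add: backward_evolution_ker flip: S_diag)
  then show ?thesis by (simp add: norm_blinfun.rep_eq)
qed

end

section \<open>From an invariant splitting to a Green kernel\<close>

locale dichotomy_splitting =
  fixes A P :: "int \<Rightarrow> 'a::real_normed_vector \<Rightarrow>\<^sub>L 'a"
  assumes splitting: "invariant_splitting A P"
begin

lemma P_idem: "P n o\<^sub>L P n = P n"
  and P_evolution: "n \<le> m \<Longrightarrow> P m o\<^sub>L evolution A m n = evolution A m n o\<^sub>L P n"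
  and bij: "n \<le> m \<Longrightarrow> bij_betw (evolution A m n) (ker (P n)) (ker (P m))"
  and backward_bound: "n \<le> m \<Longrightarrow>
    \<exists>C. \<forall>y \<in> ker (P m). norm (backward_evolution A P n m y) \<le> C * norm y"
  using splitting unfolding invariant_splitting_def by blast+

text \<open>This is A_{m,n} Q_n as a plain function: it comes from an \<open>inv_into\<close>, so
  linearity and boundedness still have to be proved.\<close>

definition R :: "int \<Rightarrow> int \<Rightarrow> 'a \<Rightarrow> 'a" where
  "R m n x = backward_evolution A P m n ((id_blinfun - P n) x)"

lemma P_idem_apply: "P n (P n x) = P n x"
  using arg_cong[OF P_idem[of n], of "\<lambda>f. blinfun_apply f x"] by simp

lemma Q_in_ker: "(id_blinfun - P n) x \<in> ker (P n)"
  by (simp add: ker_def blinfun.diff_left blinfun.diff_right P_idem_apply)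

lemma R_in_ker:
  assumes "m \<le> n"
  shows "R m n x \<in> ker (P m)"
  unfolding R_def backward_evolution_def
  using bij[OF assms] Q_in_ker[of n x] by (auto simp: bij_betw_def intro: inv_into_into)

lemma evolution_R:
  assumes "m \<le> n"
  shows "evolution A n m (R m n x) = x - P n x"
  unfolding R_def backward_evolution_def
  using bij[OF assms] Q_in_ker[of n x]
  by (auto simp: bij_betw_def f_inv_into_f blinfun.diff_left)

text \<open>Injectivity of the evolution on kernels. The identities for \<open>R\<close> below,
  linearity included, follow by checking that a candidate lies in the kernel and has the right
  image.\<close>

lemma R_unique:
  assumes "m \<le> n" "y \<in> ker (P m)" "evolution A n m y = x - P n x"
  shows "R m n x = y"
  using bij_betw_imp_inj_on[OF bij[OF assms(1)]] R_in_ker[OF assms(1), of x] assms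
    evolution_R[OF assms(1), of x]
  by (metis inj_on_def)

lemma bounded_linear_R:
  assumes "m \<le> n"
  shows "bounded_linear (R m n)"
proof -
  obtain C where C: "\<And>y. y \<in> ker (P n) \<Longrightarrow> norm (backward_evolution A P m n y) \<le> C * norm y"
    using backward_bound[OF assms] by blast
  show ?thesis
  proof (rule bounded_linear_intro)
    show "R m n (x + y) = R m n x + R m n y" for x y
      using assms R_in_ker[OF assms, of x] R_in_ker[OF assms, of y]
      by (intro R_unique) (auto simp: evolution_R ker_def blinfun.add_right)
    show "R m n (r *\<^sub>R x) = r *\<^sub>R R m n x" for r x
      using assms R_in_ker[OF assms, of x]
      by (intro R_unique) (auto simp: evolution_R ker_def blinfun.scaleR_right algebra_simps)
    \<comment> \<open>The constant of the bounded inverse comes without a sign, hence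
      \<open>\<bar>C\<bar>\<close>.\<close>
    show "norm (R m n x) \<le> norm x * (\<bar>C\<bar> * norm (id_blinfun - P n))" for x
    proof -
      have "norm (R m n x) \<le> C * norm ((id_blinfun - P n) x)"
        unfolding R_def by (intro C Q_in_ker)
      also have "\<dots> \<le> \<bar>C\<bar> * (norm (id_blinfun - P n) * norm x)"
        by (intro mult_mono norm_blinfun) auto
      finally show ?thesis by (simp add: mult_ac)
    qed
  qed
qed

definition green :: "int \<Rightarrow> int \<Rightarrow> 'a \<Rightarrow>\<^sub>L 'a" where
  "green m n = (if n \<le> m then evolution A m n o\<^sub>L P n else - Blinfun (R m n))"

lemma Blinfun_R: "m \<le> n \<Longrightarrow> Blinfun (R m n) x = R m n x"
  by (simp add: bounded_linear_Blinfun_apply bounded_linear_R)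

lemma P_commute: "P (m + 1) (A m x) = A m (P m x)"
  using arg_cong[OF P_evolution[of m "m + 1"], of "\<lambda>f. blinfun_apply f x"]
  by (simp add: evolution_step)

lemma R_diag: "R n n x = x - P n x"
  using Q_in_ker[of n x] by (intro R_unique) (auto simp: blinfun.diff_left)

lemma R_left:
  assumes "m < n"
  shows "A m (R m n x) = R (m + 1) n x"
proof (rule R_unique[symmetric])
  have "P m (R m n x) = 0"
    using R_in_ker[of m n x] assms by (simp add: ker_def)
  then show "A m (R m n x) \<in> ker (P (m + 1))"
    by (simp add: ker_def P_commute)
  have "evolution A n (m + 1) o\<^sub>L A m = evolution A n m"
    using evolution_compose[of m "m + 1" n A] assms by (simp add: evolution_step)
  then have "evolution A n (m + 1) (A m (R m n x)) = evolution A n m (R m n x)"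
    by (metis blinfun_apply_blinfun_compose)
  then show "evolution A n (m + 1) (A m (R m n x)) = x - P n x"
    using assms by (simp add: evolution_R)
qed (use assms in simp)

lemma R_right:
  assumes "m \<le> n"
  shows "R m (n + 1) (A n x) = R m n x"
  using assms R_in_ker[OF assms, of x]
  by (intro R_unique) (auto simp: evolution_Suc evolution_R P_commute blinfun.diff_right)

lemma R_P: "m \<le> n \<Longrightarrow> R m n (P n x) = 0"
  by (intro R_unique) (auto simp: ker_def P_idem_apply)

lemma green_kernel: "green_kernel A green"
  unfolding green_kernel_def
proof (intro conjI allI)
  fix m n :: int
  \<comment> \<open>At n = m + 1 the two branches of \<open>green\<close> meet, and the identity
    term accounts for \<open>P n = - (id_blinfun - P n) + id_blinfun\<close>.\<close>
  consider "n \<le> m" | "n = m + 1" | "m + 1 < n" by linarith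
  then show "green (m + 1) n = (A m o\<^sub>L green m n) + (if m + 1 = n then id_blinfun else 0)"
    by cases (auto intro!: blinfun_eqI simp: green_def evolution_Suc Blinfun_R R_left R_diag
        blinfun.add_left blinfun.minus_left blinfun.minus_right)
  consider "n + 1 \<le> m" | "n = m" | "m < n" by linarith
  then show "green m n = (green m (n + 1) o\<^sub>L A n) + (if m = n then id_blinfun else 0)"
  proof cases
    case 1
    then have "evolution A m (n + 1) o\<^sub>L A n = evolution A m n"
      using evolution_compose[of n "n + 1" m A] by (simp add: evolution_step)
    then have "evolution A m (n + 1) (A n x) = evolution A m n x" for x
      by (metis blinfun_apply_blinfun_compose)
    with 1 show ?thesis
      by (auto intro!: blinfun_eqI simp: green_def P_commute)
  qed (auto intro!: blinfun_eqI simp: green_def Blinfun_R R_right R_diag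
        blinfun.add_left blinfun.minus_left)
  show "green m n o\<^sub>L green n n = (if n \<le> m then green m n else 0)"
    by (auto intro!: blinfun_eqI simp: green_def Blinfun_R R_P P_idem blinfun_compose_assoc
        blinfun.minus_left)
qed

lemma norm_green_complement:
  assumes "m \<le> n"
  shows "norm ((if m = n then id_blinfun else 0) - green m n) =
    onorm (\<lambda>x. backward_evolution A P m n ((id_blinfun - P n) x))"
proof -
  have "blinfun_apply ((if m = n then id_blinfun else 0) - green m n) = R m n"
    using assms
    by (intro ext) (auto simp: green_def Blinfun_R R_diag blinfun.diff_left blinfun.minus_left)
  then show ?thesis by (simp only: norm_blinfun.rep_eq) (simp only: R_def [abs_def])
qed

end

text \<open>Trades inverses on kernels for algebraic recursions that can be perturbed. On the
  diagonal the Green kernel stores \<open>P n\<close>, so (D2) concerns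
  \<open>id_blinfun - G n n\<close> there and \<open>- G m n\<close> elsewhere.\<close>

lemma general_dichotomy_iff_green_kernel:
  fixes A :: "int \<Rightarrow> 'a::real_normed_vector \<Rightarrow>\<^sub>L 'a"
  shows "general_dichotomy A a b \<longleftrightarrow>
    (\<exists>G. green_kernel A G \<and> (\<forall>m n. n \<le> m \<longrightarrow> norm (G m n) \<le> a m n) \<and>
      (\<forall>m n. m \<le> n \<longrightarrow> norm ((if m = n then id_blinfun else 0) - G m n) \<le> b m n))"
proof
  assume "general_dichotomy A a b"
  then obtain P where P: "invariant_splitting A P"
    and a: "\<And>m n. n \<le> m \<Longrightarrow> norm (evolution A m n o\<^sub>L P n) \<le> a m n"
    and b: "\<And>m n. m \<le> n \<Longrightarrow>
      onorm (\<lambda>x. backward_evolution A P m n ((id_blinfun - P n) x)) \<le> b m n"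
    unfolding general_dichotomy_def by blast
  interpret dichotomy_splitting A P by unfold_locales (fact P)
  have "n \<le> m \<Longrightarrow> norm (green m n) \<le> a m n" for m n
    using a by (simp add: green_def)
  then show "\<exists>G. green_kernel A G \<and> (\<forall>m n. n \<le> m \<longrightarrow> norm (G m n) \<le> a m n) \<and>
      (\<forall>m n. m \<le> n \<longrightarrow> norm ((if m = n then id_blinfun else 0) - G m n) \<le> b m n)"
    using green_kernel norm_green_complement b by (metis (no_types, lifting))
next
  assume "\<exists>G. green_kernel A G \<and> (\<forall>m n. n \<le> m \<longrightarrow> norm (G m n) \<le> a m n) \<and>
      (\<forall>m n. m \<le> n \<longrightarrow> norm ((if m = n then id_blinfun else 0) - G m n) \<le> b m n)"
  then obtain G where G: "green_kernel A G" "\<And>m n. n \<le> m \<Longrightarrow> norm (G m n) \<le> a m n"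
    "\<And>m n. m \<le> n \<Longrightarrow> norm ((if m = n then id_blinfun else 0) - G m n) \<le> b m n"
    by blast
  interpret green A G by unfold_locales (fact G)
  show "general_dichotomy A a b"
    unfolding general_dichotomy_def
    using invariant_splitting G(2,3)
    by (intro exI[of _ "\<lambda>n. G n n"]) (simp add: evolution_G onorm_backward_evolution S_def)
qed

section \<open>Perturbation of Green kernels\<close>

lemma has_sum_diff:
  fixes f g :: "'i \<Rightarrow> 'b::real_normed_vector"
  assumes "(f has_sum s) A" "(g has_sum t) A"
  shows "((\<lambda>x. f x - g x) has_sum (s - t)) A"
  using has_sum_add[OF assms(1) has_sum_scaleR[OF assms(2), of "-1"]] by simp

text \<open>For fixed n, \<open>w m n\<close> is a weight in m and \<open>c n\<close> the size of
  column n. \<open>norm_G_B\<close> and \<open>sum_\<beta>\<close> yield the contraction constant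
  \<theta>; \<open>w_shift\<close> brings column n + 1 into the weighted space of column n, as the
  right recursion requires.\<close>

locale perturbed_green = green A G
  for A :: "int \<Rightarrow> 'a::banach \<Rightarrow>\<^sub>L 'a" and G +
  fixes B :: "int \<Rightarrow> 'a \<Rightarrow>\<^sub>L 'a" and w :: "int \<Rightarrow> int \<Rightarrow> real" and c \<beta> :: "int \<Rightarrow> real"
    and \<theta> \<kappa> :: real
  assumes w_pos: "0 < w m n"
    and w_shift: "w m (n + 1) \<le> \<kappa> * w m n"
    and norm_G: "norm (G m n) \<le> c n * w m n"
    and norm_G_B: "norm (G m (k + 1)) * norm (B k) * w k n \<le> \<beta> k * w m n"
    and sum_\<beta>: "(\<beta> has_sum \<theta>) UNIV"
    and \<theta>: "\<theta> < 1"
begin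

text \<open>Variation of constants over all integer times; the index k + 1 arises because
  \<open>B k\<close> acts in the step from k to k + 1. The default value 0 of a divergent
  \<open>infsum\<close> is excluded by \<open>T_has_sum\<close> under the weighted bound.\<close>

definition T :: "(int \<Rightarrow> 'a \<Rightarrow>\<^sub>L 'a) \<Rightarrow> int \<Rightarrow> 'a \<Rightarrow>\<^sub>L 'a" where
  "T x m = (\<Sum>\<^sub>\<infinity>k. G m (k + 1) o\<^sub>L (B k o\<^sub>L x k))"

lemma T_term_bound:
  assumes "norm (x k) \<le> C * w k n"
  shows "norm (G m (k + 1) o\<^sub>L (B k o\<^sub>L x k)) \<le> \<beta> k * (C * w m n)"
proof -
  have C: "0 \<le> C"
    using order_trans[OF norm_ge_zero assms] w_pos[of k n] by (auto simp: zero_le_mult_iff)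
  have "norm (G m (k + 1) o\<^sub>L (B k o\<^sub>L x k)) \<le> norm (G m (k + 1)) * (norm (B k) * norm (x k))"
    by (intro order_trans[OF norm_blinfun_compose] mult_left_mono norm_blinfun_compose norm_ge_zero)
  also have "\<dots> \<le> norm (G m (k + 1)) * (norm (B k) * (C * w k n))"
    by (intro mult_left_mono assms) auto
  also have "\<dots> = C * (norm (G m (k + 1)) * norm (B k) * w k n)" by simp
  also have "\<dots> \<le> C * (\<beta> k * w m n)"
    by (intro mult_left_mono norm_G_B C)
  finally show ?thesis by (simp add: mult_ac)
qed

lemma T_has_sum:
  assumes "\<And>k. norm (x k) \<le> C * w k n"
  shows "((\<lambda>k. G m (k + 1) o\<^sub>L (B k o\<^sub>L x k)) has_sum T x m) UNIV"
proof -
  have "(\<lambda>k. \<beta> k * (C * w m n)) summable_on UNIV"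
    by (rule summable_on_cmult_left) (rule has_sum_imp_summable[OF sum_\<beta>])
  then have "(\<lambda>k. norm (G m (k + 1) o\<^sub>L (B k o\<^sub>L x k))) summable_on UNIV"
    by (rule summable_on_comparison_test) (rule T_term_bound[OF assms], rule norm_ge_zero)
  then show ?thesis
    unfolding T_def by (rule has_sum_infsum[OF abs_summable_summable])
qed

lemma norm_T:
  assumes "\<And>k. norm (x k) \<le> C * w k n"
  shows "norm (T x m) \<le> \<theta> * (C * w m n)"
  by (rule norm_infsum_le[OF T_has_sum[OF assms] has_sum_cmult_left[OF sum_\<beta>]])
    (rule T_term_bound[OF assms])

lemma T_eqI:
  assumes "((\<lambda>k. G m (k + 1) o\<^sub>L (B k o\<^sub>L x k)) has_sum s) UNIV"
  shows "T x m = s"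
  unfolding T_def using assms by (rule infsumI)

lemma T_diff:
  assumes "\<And>k. norm (x k) \<le> C * w k n" "\<And>k. norm (y k) \<le> C' * w k n"
  shows "T (\<lambda>k. x k - y k) m = T x m - T y m"
  using has_sum_diff[OF T_has_sum[OF assms(1)] T_has_sum[OF assms(2)]]
  by (intro T_eqI) (simp add: blinfun_compose.diff_right)

lemma T_compose:
  assumes "\<And>k. norm (x k) \<le> C * w k n"
  shows "T (\<lambda>k. x k o\<^sub>L V) m = T x m o\<^sub>L V"
  using has_sum_bounded_linear[OF blinfun_compose.bounded_linear_left[of V] T_has_sum[OF assms]]
  by (intro T_eqI) (simp add: blinfun_compose_assoc)

section \<open>Unique solvability of the summation equation\<close>

lemma \<theta>_nonneg: "0 \<le> \<theta>"
proof -
  have "0 \<le> \<beta> k" for k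
  proof -
    have "0 \<le> \<beta> k * w 0 0"
      by (rule order_trans[OF _ norm_G_B[of 0 k 0]]) (simp add: w_pos less_imp_le)
    then show ?thesis using w_pos[of 0 0] by (auto simp: zero_le_mult_iff)
  qed
  then show ?thesis using has_sum_nonneg[OF sum_\<beta>] by blast
qed

text \<open>The difference is a fixed point of the linear map \<open>T\<close>, so iterating
  \<open>norm_T\<close> gains a factor \<theta> each time. The constants C, C' and the inhomogeneity
  h are free because the later comparisons involve different bounds and an h other than
  \<open>G m n\<close>.\<close>

lemma fixpoint_unique:
  assumes x: "\<And>m. norm (x m) \<le> C * w m n" and y: "\<And>m. norm (y m) \<le> C' * w m n"
    and "\<And>m. x m = h m + T x m" "\<And>m. y m = h m + T y m"
  shows "x m = y m"
proof -
  define d where "d = (\<lambda>m. x m - y m)"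
  have d: "d m = T d m" for m
    unfolding d_def using T_diff[OF x y, of m] assms(3,4)[of m] by (simp add: algebra_simps)
  have "norm (d m) \<le> \<theta> ^ i * (C + C') * w m n" for i m
  proof (induction i arbitrary: m)
    case 0
    show ?case using x[of m] y[of m] norm_triangle_ineq4[of "x m" "y m"]
      by (simp add: d_def algebra_simps)
  next
    case (Suc i)
    show ?case using norm_T[of d, OF Suc.IH, of m] by (simp add: mult_ac flip: d)
  qed
  moreover have "(\<lambda>i. \<theta> ^ i * (C + C') * w m n) \<longlonglongrightarrow> 0 * (C + C') * w m n"
    using \<theta> \<theta>_nonneg by (intro tendsto_mult tendsto_const LIMSEQ_power_zero) auto
  ultimately have "norm (d m) \<le> 0"
    by (intro LIMSEQ_le_const) auto
  then show ?thesis by (simp add: d_def)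
qed

text \<open>Picard iteration from 0, carried out entry by entry in m with weighted bounds in place
  of a norm on a sequence space.\<close>

lemma fixpoint_exists:
  "\<exists>x. \<forall>m. norm (x m) \<le> c n / (1 - \<theta>) * w m n \<and> x m = G m n + T x m"
proof -
  define K where "K = c n / (1 - \<theta>)"
  define X where "X = rec_nat (\<lambda>m. 0) (\<lambda>_ x m. G m n + T x m)"
  have X_Suc: "X (Suc i) m = G m n + T (X i) m" for i m
    by (simp add: X_def)
  have "0 \<le> c n"
    using order_trans[OF norm_ge_zero norm_G[of n n]] w_pos[of n n] by (auto simp: zero_le_mult_iff)
  then have "0 \<le> K" using \<theta> by (simp add: K_def)
  \<comment> \<open>This equation makes the weighted ball of radius K invariant under the
    iteration.\<close>
  have K: "c n + \<theta> * K = K"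
    using \<theta> by (simp add: K_def field_simps)
  have X: "norm (X i m) \<le> K * w m n" for i m
  proof (induction i arbitrary: m)
    case 0
    then show ?case using \<open>0 \<le> K\<close> w_pos[of m n] by (simp add: X_def)
  next
    case (Suc i)
    have "norm (X (Suc i) m) \<le> c n * w m n + \<theta> * (K * w m n)"
      unfolding X_Suc by (intro norm_triangle_le add_mono norm_G norm_T Suc.IH)
    also have "\<dots> = (c n + \<theta> * K) * w m n" by (simp add: algebra_simps)
    finally show ?case unfolding K .
  qed
  \<comment> \<open>The bound is independent of p: it gives the Cauchy property and, as p tends to
    infinity, the rate of convergence.\<close>
  have diff: "norm (X (i + p) m - X i m) \<le> \<theta> ^ i * K * w m n" for i p m
  proof (induction i arbitrary: m)
    case 0
    then show ?case using X[of p m] by (simp add: X_def)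
  next
    case (Suc i)
    have "X (Suc i + p) m - X (Suc i) m = T (\<lambda>m. X (i + p) m - X i m) m"
      by (simp add: X_Suc T_diff[OF X X])
    then show ?case
      using norm_T[of "\<lambda>m. X (i + p) m - X i m", OF Suc.IH, of m] by (simp add: mult_ac)
  qed
  have null: "(\<lambda>i. \<theta> ^ i * K * w m n) \<longlonglongrightarrow> 0" for m
    using tendsto_mult[OF tendsto_mult[OF LIMSEQ_power_zero[of \<theta>] tendsto_const] tendsto_const]
      \<theta> \<theta>_nonneg by simp
  have "Cauchy (\<lambda>i. X i m)" for m
  proof (rule metric_CauchyI)
    fix e :: real
    assume "0 < e"
    then obtain N where "\<theta> ^ N * K * w m n < e / 2"
      using order_tendstoD(2)[OF null[of m], of "e / 2"] by (auto simp: eventually_sequentially)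
    then have *: "dist (X i m) (X N m) < e / 2" if "N \<le> i" for i
      using diff[of N "i - N" m] that by (simp add: dist_norm)
    show "\<exists>N. \<forall>i\<ge>N. \<forall>j\<ge>N. dist (X i m) (X j m) < e"
      by (intro exI[of _ N] allI impI) (rule dist_triangle_half_l[OF * *])
  qed
  moreover define x where "x m = lim (\<lambda>i. X i m)" for m
  ultimately have x: "(\<lambda>i. X i m) \<longlonglongrightarrow> x m" for m
    by (simp add: Cauchy_convergent_iff convergent_LIMSEQ_iff)
  have bound: "norm (x m) \<le> K * w m n" for m
    using LIMSEQ_le_const2[OF tendsto_norm[OF x]] X by blast
  have rate: "norm (x m - X i m) \<le> \<theta> ^ i * K * w m n" for i m
  proof (rule LIMSEQ_le_const2)
    show "(\<lambda>p. norm (X (p + i) m - X i m)) \<longlonglongrightarrow> norm (x m - X i m)"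
      by (intro tendsto_norm tendsto_diff tendsto_const LIMSEQ_ignore_initial_segment x)
    show "\<exists>N. \<forall>p\<ge>N. norm (X (p + i) m - X i m) \<le> \<theta> ^ i * K * w m n"
      using diff[of i _ m] by (simp add: add.commute)
  qed
  \<comment> \<open>The rate is uniform in m relative to the weight, so \<open>norm_T\<close> lets
    the limit pass under the infinite sum.\<close>
  have "x m = G m n + T x m" for m
  proof (rule LIMSEQ_unique)
    have "norm (T x m - T (X i) m) \<le> \<theta> * (\<theta> ^ i * K * w m n)" for i
      using norm_T[OF rate, of i m] by (simp add: T_diff[OF bound X])
    then have "(\<lambda>i. T x m - T (X i) m) \<longlonglongrightarrow> 0"
      by (intro Lim_null_comparison[OF always_eventually tendsto_mult_right_zero[OF null]] allI)
    then have "(\<lambda>i. G m n + (T x m - (T x m - T (X i) m))) \<longlonglongrightarrow> G m n + (T x m - 0)"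
      by (intro tendsto_add tendsto_diff tendsto_const)
    then show "(\<lambda>i. X (Suc i) m) \<longlonglongrightarrow> G m n + T x m"
      by (simp add: X_Suc)
  qed (rule LIMSEQ_Suc[OF x])
  with bound show ?thesis unfolding K_def by (intro exI[of _ x] allI conjI)
qed

text \<open>The choice fixes a whole column n before it is evaluated at m, so one and the same
  sequence satisfies the equation at every m.\<close>

definition H :: "int \<Rightarrow> int \<Rightarrow> 'a \<Rightarrow>\<^sub>L 'a" where
  "H m n = (SOME x. \<forall>m. norm (x m) \<le> c n / (1 - \<theta>) * w m n \<and> x m = G m n + T x m) m"

section \<open>Recursions and absorption law of the perturbed kernel\<close>

lemma norm_H: "norm (H m n) \<le> c n / (1 - \<theta>) * w m n"
  and H_fixpoint: "H m n = G m n + T (\<lambda>k. H k n) m"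
  using someI_ex[OF fixpoint_exists[of n]] unfolding H_def by blast+

lemma norm_H_diff: "norm (H m n - G m n) \<le> \<theta> * (c n / (1 - \<theta>) * w m n)"
  using norm_T[OF norm_H] H_fixpoint[of m n] by simp

text \<open>Applying \<open>A m\<close> to the summation equation advances
  \<open>G m (k + 1)\<close>; its identity term occurs only for k = m and contributes exactly
  \<open>B m o\<^sub>L H m n\<close>.\<close>

lemma H_left: "H (m + 1) n = ((A m + B m) o\<^sub>L H m n) + (if m + 1 = n then id_blinfun else 0)"
proof -
  have "((\<lambda>k. A m o\<^sub>L (G m (k + 1) o\<^sub>L (B k o\<^sub>L H k n))) has_sum A m o\<^sub>L T (\<lambda>k. H k n) m) UNIV"
    by (rule has_sum_bounded_linear[OF blinfun_compose.bounded_linear_right T_has_sum[OF norm_H]])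
  moreover have "((\<lambda>k. if k = m then B k o\<^sub>L H k n else 0) has_sum B m o\<^sub>L H m n) UNIV"
    by (rule has_sum_finite_neutralI[where B = "{m}"]) auto
  ultimately have "T (\<lambda>k. H k n) (m + 1) = (A m o\<^sub>L T (\<lambda>k. H k n) m) + (B m o\<^sub>L H m n)"
    by (intro T_eqI) (rule has_sum_cong[THEN iffD1, OF _ has_sum_add],
        auto simp: left blinfun_compose_algebra)
  then show ?thesis
    using H_fixpoint[of "m + 1" n] H_fixpoint[of m n] left[of m n]
    by (simp add: blinfun_compose_algebra)
qed

text \<open>The right-hand side, as a sequence in m, is a weighted solution of the summation
  equation of column n; uniqueness identifies it with \<open>H\<close>.\<close>

lemma H_right: "H m n = (H m (n + 1) o\<^sub>L (A n + B n)) + (if m = n then id_blinfun else 0)"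
proof -
  let ?V = "A n + B n"
  define x where "x m = (H m (n + 1) o\<^sub>L ?V) + (if m = n then id_blinfun else 0)" for m
  have c: "0 \<le> c n / (1 - \<theta>)" for n
    using order_trans[OF norm_ge_zero norm_H[of n n]] w_pos[of n n]
    by (simp only: zero_le_mult_iff) auto
  let ?C = "c (n + 1) / (1 - \<theta>) * \<kappa> * norm ?V"
  have HV: "norm (H m (n + 1) o\<^sub>L ?V) \<le> ?C * w m n" for m
  proof -
    have "norm (H m (n + 1) o\<^sub>L ?V) \<le> norm (H m (n + 1)) * norm ?V"
      by (rule norm_blinfun_compose)
    also have "\<dots> \<le> (c (n + 1) / (1 - \<theta>) * (\<kappa> * w m n)) * norm ?V"
      by (intro mult_right_mono order_trans[OF norm_H] mult_left_mono w_shift c) auto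
    finally show ?thesis by (simp add: mult_ac)
  qed
  \<comment> \<open>A sequence with a single nonzero entry fits the weight with constant
    \<open>1 / w n n\<close>.\<close>
  have I: "norm (if m = n then id_blinfun :: 'a \<Rightarrow>\<^sub>L 'a else 0) \<le> 1 / w n n * w m n" for m
    using w_pos[of m n] w_pos[of n n] norm_blinfun_id_le
    by (auto intro: divide_nonneg_nonneg less_imp_le)
  have "norm (x m) \<le> (?C + 1 / w n n) * w m n" for m
    unfolding x_def distrib_right by (intro norm_triangle_le add_mono HV I)
  moreover have "x m = G m n + T x m" for m
  proof -
    \<comment> \<open>The identity entry at k = n contributes
      \<open>G m (n + 1) o\<^sub>L B n\<close>, which completes the \<open>A n\<close> in the right
      recursion of \<open>G\<close> to \<open>A n + B n\<close>.\<close>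
    have "((\<lambda>k. if k = n then G m (k + 1) o\<^sub>L B k else 0) has_sum G m (n + 1) o\<^sub>L B n) UNIV"
      by (rule has_sum_finite_neutralI[where B = "{n}"]) auto
    from has_sum_add[OF T_has_sum[of "\<lambda>k. H k (n + 1) o\<^sub>L ?V", OF HV] this]
    have "((\<lambda>k. G m (k + 1) o\<^sub>L (B k o\<^sub>L x k)) has_sum
        T (\<lambda>k. H k (n + 1) o\<^sub>L ?V) m + (G m (n + 1) o\<^sub>L B n)) UNIV"
      by (rule iffD1[OF has_sum_cong, rotated]) (simp add: x_def blinfun_compose.add_right)
    then have "T x m = (T (\<lambda>k. H k (n + 1)) m o\<^sub>L ?V) + (G m (n + 1) o\<^sub>L B n)"
      unfolding T_compose[OF norm_H] by (rule T_eqI)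
    then show ?thesis
      using H_fixpoint[of m "n + 1"] right[of m n] unfolding x_def
      by (simp add: blinfun_compose_algebra)
  qed
  ultimately have "H m n = x m"
    by (rule fixpoint_unique[OF norm_H _ H_fixpoint])
  then show ?thesis by (simp add: x_def)
qed

text \<open>Both sides solve \<open>x m = G m n H n n + T x m\<close>; for the right-hand side this follows by applying
  \<open>G m n\<close> to the equation for \<open>H n n\<close> and using the composition rule of \<open>G\<close>.\<close>
lemma H_absorb: "H m n o\<^sub>L H n n = (if n \<le> m then H m n else 0)"
proof -
  define z where "z m = (of_bool (n \<le> m) :: real) *\<^sub>R H m n" for m
  have z: "norm (z m) \<le> c n / (1 - \<theta>) * w m n" for m
    using norm_H[of m n] order_trans[OF norm_ge_zero norm_H[of m n]] by (auto simp: z_def)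
  have HH: "norm (H m n o\<^sub>L H n n) \<le> (c n / (1 - \<theta>) * norm (H n n)) * w m n" for m
    using order_trans[OF norm_blinfun_compose
        mult_right_mono[OF norm_H[of m n] norm_ge_zero[of "H n n"]]]
    by (simp add: mult_ac)
  have "H m n o\<^sub>L H n n = (G m n o\<^sub>L H n n) + T (\<lambda>k. H k n o\<^sub>L H n n) m" for m
    by (subst H_fixpoint[of m n]) (simp add: T_compose[OF norm_H] blinfun_compose.add_left)
  moreover have "z m = (G m n o\<^sub>L H n n) + T z m" for m
  proof -
    have "((\<lambda>k. G m n o\<^sub>L (G n (k + 1) o\<^sub>L (B k o\<^sub>L H k n))) has_sum G m n o\<^sub>L T (\<lambda>k. H k n) n) UNIV"
      by (rule has_sum_bounded_linear[OF blinfun_compose.bounded_linear_right T_has_sum[OF norm_H]])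
    \<comment> \<open>\<open>G_compose\<close> with middle index n: its negative part has the
      condition \<open>n < k + 1\<close>, that is n \<le> k, which is where \<open>z k\<close> is
      \<open>H k n\<close> rather than 0.\<close>
    moreover have "G m n o\<^sub>L (G n (k + 1) o\<^sub>L (B k o\<^sub>L H k n)) =
        of_bool (n \<le> m) *\<^sub>R (G m (k + 1) o\<^sub>L (B k o\<^sub>L H k n)) - (G m (k + 1) o\<^sub>L (B k o\<^sub>L z k))" for k
    proof -
      have "G m n o\<^sub>L (G n (k + 1) o\<^sub>L (B k o\<^sub>L H k n)) =
          ((of_bool (n \<le> m) - of_bool (n < k + 1)) *\<^sub>R G m (k + 1)) o\<^sub>L (B k o\<^sub>L H k n)"
        by (simp only: G_compose flip: blinfun_compose_assoc)
      then show ?thesis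
        by (auto simp: z_def blinfun_compose.minus_left)
    qed
    moreover have "((\<lambda>k. of_bool (n \<le> m) *\<^sub>R (G m (k + 1) o\<^sub>L (B k o\<^sub>L H k n)) - (G m (k + 1) o\<^sub>L (B k o\<^sub>L z k)))
        has_sum (of_bool (n \<le> m) *\<^sub>R T (\<lambda>k. H k n) m - T z m)) UNIV"
      by (rule has_sum_diff[OF has_sum_scaleR[OF T_has_sum[OF norm_H]] T_has_sum[OF z]])
    ultimately have "G m n o\<^sub>L T (\<lambda>k. H k n) n = of_bool (n \<le> m) *\<^sub>R T (\<lambda>k. H k n) m - T z m"
      by (simp add: has_sum_unique)
    \<comment> \<open>\<open>absorb\<close> puts the same cutoff on
      \<open>G m n o\<^sub>L G n n\<close>, so inhomogeneity and sum reassemble into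
      \<open>H m n\<close>.\<close>
    then have "G m n o\<^sub>L H n n = of_bool (n \<le> m) *\<^sub>R (G m n + T (\<lambda>k. H k n) m) - T z m"
      using H_fixpoint[of n n] by (simp add: blinfun_compose.add_right absorb)
    then show ?thesis using H_fixpoint[of m n] by (simp add: z_def)
  qed
  ultimately have "H m n o\<^sub>L H n n = z m"
    using fixpoint_unique[OF HH z, where h = "\<lambda>m. G m n o\<^sub>L H n n"] by blast
  then show ?thesis by (simp add: z_def)
qed

lemma green_kernel_H: "green_kernel (\<lambda>n. A n + B n) H"
  unfolding green_kernel_def using H_left H_right H_absorb by blast

end

section \<open>The two-sided geometric series and the exponential bounds\<close>

lemma has_sum_power_abs_int:
  fixes q :: real
  assumes "0 \<le> q" "q < 1"
  shows "((\<lambda>k::int. q ^ nat \<bar>k\<bar>) has_sum ((q + 1) / (1 - q))) UNIV"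
proof -
  have q: "((\<lambda>i. q ^ i) has_sum (1 / (1 - q))) UNIV"
    using assms geometric_sums[of q] by (simp add: sums_nonneg_imp_has_sum)
  have "((\<lambda>k::int. q ^ nat \<bar>k\<bar>) has_sum (1 / (1 - q))) {0..}"
    using q by (subst has_sum_reindex_bij_witness[where i = int and j = nat and h = "\<lambda>i. q ^ i" and T = UNIV]) auto
  \<comment> \<open>Negative k are written -(i + 1), which leaves one extra factor q.\<close>
  moreover have "((\<lambda>k::int. q ^ nat \<bar>k\<bar>) has_sum (q * (1 / (1 - q)))) {..<0}"
    using has_sum_cmult_right[OF q, of q]
    by (subst has_sum_reindex_bij_witness[where i = "\<lambda>i. - int (Suc i)" and j = "\<lambda>k. nat (- k - 1)"
          and h = "\<lambda>i. q * q ^ i" and T = UNIV])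
      (auto simp: nat_diff_distrib' Suc_nat_eq_nat_zadd1 simp flip: power_Suc)
  ultimately have "((\<lambda>k::int. q ^ nat \<bar>k\<bar>) has_sum (1 / (1 - q) + q * (1 / (1 - q)))) ({0..} \<union> {..<0})"
    by (intro has_sum_Un_disjoint) auto
  moreover have "{0..} \<union> {..<0} = (UNIV :: int set)" by auto
  moreover have "1 / (1 - q) + q * (1 / (1 - q)) = (q + 1) / (1 - q)"
    using assms by (simp add: field_simps)
  ultimately show ?thesis by simp
qed

theorem corollary3:
  fixes A B :: "int \<Rightarrow> 'a::banach \<Rightarrow>\<^sub>L 'a"
    and D \<epsilon> a b \<delta> \<gamma> \<theta> :: real
  assumes "D \<ge> 1" and "\<epsilon> \<ge> 0"
    and "general_dichotomy A
           (\<lambda>m n. D * exp (a * real_of_int (m - n) + \<epsilon> * real_of_int \<bar>n\<bar>))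
           (\<lambda>m n. D * exp (b * real_of_int (m - n) + \<epsilon> * real_of_int \<bar>n\<bar>))"
    and "\<delta> > 0"
    and "\<And>n. norm (B n) \<le> \<delta> * exp (- \<gamma> * real_of_int \<bar>n + 1\<bar>)"
    and "a \<le> b" and "\<epsilon> - \<gamma> < 0"
    and "\<theta> = D * \<delta> * exp (- a) * (exp (\<epsilon> - \<gamma>) + 1) * inverse (1 - exp (\<epsilon> - \<gamma>))"
    and "\<theta> < 1"
  shows "general_dichotomy (\<lambda>n. A n + B n)
           (\<lambda>m n. D / (1 - \<theta>) * exp (a * real_of_int (m - n) + \<epsilon> * real_of_int \<bar>n\<bar>))
           (\<lambda>m n. D / (1 - \<theta>) * exp (b * real_of_int (m - n) + \<epsilon> * real_of_int \<bar>n\<bar>))"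
proof -
  obtain G where G: "green_kernel A G"
    and Ga: "\<And>m n. n \<le> m \<Longrightarrow> norm (G m n) \<le> D * exp (a * real_of_int (m - n) + \<epsilon> * real_of_int \<bar>n\<bar>)"
    and Gb: "\<And>m n. m \<le> n \<Longrightarrow> norm ((if m = n then id_blinfun else 0) - G m n) \<le>
      D * exp (b * real_of_int (m - n) + \<epsilon> * real_of_int \<bar>n\<bar>)"
    using assms(3) unfolding general_dichotomy_iff_green_kernel by blast
  define e where "e m n = min (a * real_of_int (m - n)) (b * real_of_int (m - n))" for m n
  have e_ge: "n \<le> m \<Longrightarrow> e m n = a * real_of_int (m - n)" for m n
    unfolding e_def using \<open>a \<le> b\<close> by (intro min_absorb1 mult_right_mono) auto
  have e_le: "m \<le> n \<Longrightarrow> e m n = b * real_of_int (m - n)" for m n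
    unfolding e_def using \<open>a \<le> b\<close> by (intro min_absorb2 mult_right_mono_neg) auto
  \<comment> \<open>The two time differences add up to m - n - 1. Bounding both minima by their
    a-branches gives the term -a, by their b-branches -b, and -b \<le> -a.\<close>
  have e_compose: "e m (k + 1) + e k n \<le> e m n - a" for m k n
  proof -
    have "e m (k + 1) + e k n \<le> a * real_of_int (m - n) - a"
      "e m (k + 1) + e k n \<le> b * real_of_int (m - n) - b"
      unfolding e_def by (auto simp: min_def algebra_simps)
    then show ?thesis using \<open>a \<le> b\<close> by (simp add: e_def min_def)
  qed
  define w where "w m n = exp (e m n)" for m n
  define c where "c n = D * exp (\<epsilon> * real_of_int \<bar>n\<bar>)" for n
  \<comment> \<open>The growth factor of \<open>G m (k + 1)\<close> and the decay of
    \<open>B k\<close> are both taken at k + 1, leaving a power of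
    \<open>exp (\<epsilon> - \<gamma>)\<close>; \<open>exp (- a)\<close> is the loss in
    \<open>e_compose\<close>.\<close>
  define \<beta> where "\<beta> k = D * \<delta> * exp (- a) * exp (\<epsilon> - \<gamma>) ^ nat \<bar>k + 1\<bar>" for k :: int
  have norm_G: "norm (G m n) \<le> c n * w m n" for m n
  proof (cases "n \<le> m")
    case True
    then show ?thesis using Ga[of n m] by (simp add: c_def w_def e_ge exp_add mult_ac)
  next
    case False
    then show ?thesis using Gb[of m n] by (simp add: c_def w_def e_le exp_add mult_ac)
  qed
  have pow: "exp (\<epsilon> - \<gamma>) ^ nat \<bar>k\<bar> = exp (\<epsilon> * real_of_int \<bar>k\<bar>) * exp (- \<gamma> * real_of_int \<bar>k\<bar>)" for k :: int
    by (simp add: algebra_simps flip: exp_add exp_of_nat_mult)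
  interpret perturbed_green A G B w c \<beta> \<theta> "exp (- a)"
  proof
    show "green_kernel A G" by (fact G)
    show "0 < w m n" for m n by (simp add: w_def)
    \<comment> \<open>The instance k = n of \<open>e_compose\<close>, where \<open>e n n\<close>
      vanishes.\<close>
    show "w m (n + 1) \<le> exp (- a) * w m n" for m n
      using e_compose[of m n n] by (simp add: w_def e_def flip: exp_add)
    show "norm (G m n) \<le> c n * w m n" for m n by (fact norm_G)
    show "norm (G m (k + 1)) * norm (B k) * w k n \<le> \<beta> k * w m n" for m k n
    proof -
      have "norm (G m (k + 1)) * norm (B k) * w k n \<le>
          (c (k + 1) * w m (k + 1)) * (\<delta> * exp (- \<gamma> * real_of_int \<bar>k + 1\<bar>)) * w k n"
        by (intro mult_mono norm_G assms(5) mult_right_mono)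
          (use \<open>D \<ge> 1\<close> in \<open>auto simp: c_def w_def\<close>)
      also have "\<dots> = D * \<delta> * exp (\<epsilon> - \<gamma>) ^ nat \<bar>k + 1\<bar> * exp (e m (k + 1) + e k n)"
        unfolding pow by (simp add: c_def w_def exp_add mult_ac)
      also have "\<dots> \<le> D * \<delta> * exp (\<epsilon> - \<gamma>) ^ nat \<bar>k + 1\<bar> * exp (e m n - a)"
        using \<open>D \<ge> 1\<close> \<open>\<delta> > 0\<close> e_compose[of m k n] by (intro mult_left_mono) auto
      also have "\<dots> = \<beta> k * w m n"
        by (simp add: \<beta>_def w_def exp_diff exp_minus divide_inverse mult_ac)
      finally show ?thesis .
    qed
    have "((\<lambda>k::int. exp (\<epsilon> - \<gamma>) ^ nat \<bar>k + 1\<bar>) has_sum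
        ((exp (\<epsilon> - \<gamma>) + 1) / (1 - exp (\<epsilon> - \<gamma>)))) UNIV"
      using has_sum_power_abs_int[of "exp (\<epsilon> - \<gamma>)"] \<open>\<epsilon> - \<gamma> < 0\<close>
      by (subst has_sum_reindex_bij_witness[where i = "\<lambda>k. k - 1" and j = "\<lambda>k. k + 1"
            and h = "\<lambda>k. exp (\<epsilon> - \<gamma>) ^ nat \<bar>k\<bar>" and T = UNIV]) auto
    from has_sum_cmult_right[OF this, of "D * \<delta> * exp (- a)"]
    show "(\<beta> has_sum \<theta>) UNIV"
      unfolding \<beta>_def assms(8) by (simp add: divide_inverse mult_ac)
    show "\<theta> < 1" by fact
  qed
  have H_bound: "norm (H m n) \<le> D / (1 - \<theta>) * exp (e m n + \<epsilon> * real_of_int \<bar>n\<bar>)" for m n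
    using norm_H[of m n] by (simp add: c_def w_def exp_add mult_ac)
  \<comment> \<open>\<open>norm_H\<close> bounds \<open>H n n\<close> and not its complement.
    Splitting at \<open>G n n\<close> gives the same constant, as 1 + \<theta> / (1 - \<theta>) = 1
    / (1 - \<theta>).\<close>
  have "norm (id_blinfun - H n n) \<le> D / (1 - \<theta>) * exp (\<epsilon> * real_of_int \<bar>n\<bar>)" for n
  proof -
    have "norm (id_blinfun - H n n) \<le> norm (id_blinfun - G n n) + norm (H n n - G n n)"
      using norm_triangle_ineq4[of "id_blinfun - G n n" "H n n - G n n"] by simp
    also have "\<dots> \<le> D * exp (\<epsilon> * real_of_int \<bar>n\<bar>) +
        \<theta> * (D * exp (\<epsilon> * real_of_int \<bar>n\<bar>) / (1 - \<theta>))"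
      using Gb[of n n] norm_H_diff[of n n] by (intro add_mono) (simp_all add: c_def w_def e_def)
    also have "\<dots> = D / (1 - \<theta>) * exp (\<epsilon> * real_of_int \<bar>n\<bar>)"
      using \<open>\<theta> < 1\<close> by (simp add: field_simps)
    finally show ?thesis .
  qed
  then have "norm ((if m = n then id_blinfun else 0) - H m n) \<le>
      D / (1 - \<theta>) * exp (b * real_of_int (m - n) + \<epsilon> * real_of_int \<bar>n\<bar>)" if "m \<le> n" for m n
    using H_bound[of m n] that by (cases "m = n") (simp_all add: e_le)
  moreover have "norm (H m n) \<le> D / (1 - \<theta>) * exp (a * real_of_int (m - n) + \<epsilon> * real_of_int \<bar>n\<bar>)"
    if "n \<le> m" for m n
    using H_bound[of m n] that by (simp add: e_ge)
  ultimately show ?thesis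
    unfolding general_dichotomy_iff_green_kernel using green_kernel_H by blast
qed

end
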